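(* Let $d\ge 2$ and let $F=(a,x)\in\mathcal{P}_d$, with amplitudes vector $a=(a_1,\ldots,a_d)$ and nodes vector $x=(x_1,\ldots,x_d)$. Then $F\in\Sigma_{d,1,2}$ if and only if $a_i\neq 0$ for $i=1,\ldots,d$ and exactly one of the following mutually exclusive conditions is met: (I) $m_0(F)=0$ and the amplitudes vector $a$ is in the null space of $V^{0:2}(x)$; (II) $m_0(F)\neq 0$ and the amplitudes vector $a$ is a zero of the quadratic form $a^{T}D(x)a$, i.e. $a^{T}D(x)a=0$.
   Context: For $d\ge 1$, $\mathcal{P}_d=\{(a,x)=(a_1,\ldots,a_d,x_1,\ldots,x_d)\in\mathbb{R}^{2d} : x_1<x_2<\cdots<x_d,\ a_i\neq 0,\ i=1,\ldots,d\}$. A tuple $(a,x)\in\mathcal{P}_d$ is identified with the spike-train signal $F(x)=\sum_{j=1}^d a_j\delta(x-x_j)$ with $d$ nodes. $\mathcal{P}_0$ is the singleton containing the zero signal $F_0=0$. The moments of a signal are $m_k(F)=\sum_{j=1}^d a_jx_j^k$, $k=0,1,2,\ldots$ (with $x_j^0=1$); all moments of the zero signal are $0$. For $d\ge 2$, $\Sigma_{d,1,2}\subset\mathcal{P}_d$ is the set of all $F\in\mathcal{P}_d$ such that there exists a signal $\tilde F\in\mathcal{P}_0\cup\mathcal{P}_1$ (at most one node) with $m_k(\tilde F)=m_k(F)$ for $k=0,1,2$. $V^{0:2}(x)$ is the $3\times d$ Vandermonde matrix whose rows are $(1,\ldots,1)$, $(x_1,\ldots,x_d)$ and $(x_1^2,\ldots,x_d^2)$.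 $D(x)$ is the $d\times d$ Euclidean distance matrix with entries $D_{i,j}=(x_i-x_j)^2$. *)

theory Defs
  imports "Jordan_Normal_Form.Matrix_Kernel"
begin

text \<open>A signal with \<open>d\<close> nodes is the pair of its amplitude vector and its node vector. Indices
  run over \<open>0, \<dots>, d - 1\<close> instead of \<open>1, \<dots>, d\<close>. The space \<open>\<P> 0\<close> has the pair of empty
  vectors as its only element; this is the zero signal.\<close>

type_synonym signal = "real vec \<times> real vec"

definition signals :: "nat \<Rightarrow> signal set" ("\<P>") where
  "\<P> d = {(a, x). a \<in> carrier_vec d \<and> x \<in> carrier_vec d \<and>
           (\<forall>i j. i < j \<and> j < d \<longrightarrow> x $ i < x $ j) \<and> (\<forall>i<d. a $ i \<noteq> 0)}"

fun moment :: "nat \<Rightarrow> signal \<Rightarrow> real" where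
  "moment k (a, x) = (\<Sum>j<dim_vec a. a $ j * (x $ j) ^ k)"

definition Sigma_1_2 :: "nat \<Rightarrow> signal set" where
  "Sigma_1_2 d = {F \<in> \<P> d. \<exists>F' \<in> \<P> 0 \<union> \<P> 1. \<forall>k \<in> {0, 1, 2}. moment k F' = moment k F}"

definition vandermonde_0_2 :: "real vec \<Rightarrow> real mat" where
  "vandermonde_0_2 x = mat 3 (dim_vec x) (\<lambda>(k, j). (x $ j) ^ k)"

definition dist_mat :: "real vec \<Rightarrow> real mat" where
  "dist_mat x = mat (dim_vec x) (dim_vec x) (\<lambda>(i, j). (x $ i - x $ j)\<^sup>2)"

end

(* A signal with at most one node has moments (0, 0, 0) or (b, b t, b t^2) with b nonzero, so F lies
   in Sigma_{d,1,2} iff its first three moments vanish, or m_0 is nonzero and m_0 m_2 = m_1^2.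
   Expanding the square (x_i - x_j)^2 gives a^T D(x) a = 2 (m_0 m_2 - m_1^2). *)

theory Submission
  imports Defs
begin

lemma signals_0: "\<P> 0 = {(vNil, vNil)}"
  by (auto simp: signals_def)

lemma vec_singleton_in_signals_1: "(vec 1 (\<lambda>_. b), vec 1 (\<lambda>_. t)) \<in> \<P> 1" if "b \<noteq> 0"
  using that by (auto simp: signals_def)

text \<open>The zero signal accounts for the first alternative. For one node the moments form a
  geometric progression whose initial term is the nonzero amplitude, which accounts for the second.
  Only the three prescribed values matter, so \<open>m\<close> is arbitrary.\<close>

lemma ex_signal_at_most_one_node_iff:
  fixes m :: "nat \<Rightarrow> real"
  shows "(\<exists>F \<in> \<P> 0 \<union> \<P> 1. \<forall>k \<in> {0, 1, 2}. moment k F = m k) \<longleftrightarrow>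
    (\<forall>k \<in> {0, 1, 2}. m k = 0) \<or> m 0 \<noteq> 0 \<and> m 0 * m 2 = (m 1)\<^sup>2"
  (is "?L \<longleftrightarrow> ?R")
proof
  assume ?L
  then obtain F where F: "F \<in> \<P> 0 \<union> \<P> 1" "\<And>k. k \<in> {0, 1, 2} \<Longrightarrow> moment k F = m k"
    by blast
  from F(1) show ?R
  proof
    assume "F \<in> \<P> 0"
    then show ?R
      using F(2) by (auto simp: signals_0)
  next
    assume "F \<in> \<P> 1"
    then obtain b t where bt: "F = (b, t)" "dim_vec b = 1" "b $ 0 \<noteq> 0"
      by (auto simp: signals_def)
    have "m 0 = b $ 0" "m 1 = b $ 0 * t $ 0" "m 2 = b $ 0 * (t $ 0)\<^sup>2"
      using F(2)[of 0] F(2)[of 1] F(2)[of 2] bt by auto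
    then show ?R
      using bt(3) by (simp add: power2_eq_square)
  qed
next
  assume ?R
  then show ?L
  proof
    assume "\<forall>k \<in> {0, 1, 2}. m k = 0"
    then show ?L
      by (intro bexI[of _ "(vNil, vNil)"]) (auto simp: signals_0)
  next
    assume m: "m 0 \<noteq> 0 \<and> m 0 * m 2 = (m 1)\<^sup>2"
    \<comment> \<open>The values \<open>m 0\<close> and \<open>m 1\<close> force the amplitude
      \<open>m 0\<close> and the node \<open>m 1 / m 0\<close>; the quadratic relation then makes
      the second moment agree.\<close>
    then have "\<forall>k \<in> {0, 1, 2}. moment k (vec 1 (\<lambda>_. m 0), vec 1 (\<lambda>_. m 1 / m 0)) = m k"
      by (auto simp: field_simps power2_eq_square)
    then show ?L
      using m vec_singleton_in_signals_1[of "m 0" "m 1 / m 0"] by blast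
  qed
qed

lemma vandermonde_0_2_carrier: "vandermonde_0_2 x \<in> carrier_mat 3 (dim_vec x)"
  unfolding vandermonde_0_2_def by (rule mat_carrier)

lemma vandermonde_0_2_mult_vec:
  assumes "dim_vec a = dim_vec x"
  shows "vandermonde_0_2 x *\<^sub>v a = vec 3 (\<lambda>k. moment k (a, x))"
proof (rule eq_vecI)
  show "dim_vec (vandermonde_0_2 x *\<^sub>v a) = dim_vec (vec 3 (\<lambda>k. moment k (a, x)))"
    using vandermonde_0_2_carrier[of x] by simp
next
  fix k
  assume "k < dim_vec (vec 3 (\<lambda>k. moment k (a, x)))"
  then show "(vandermonde_0_2 x *\<^sub>v a) $ k = vec 3 (\<lambda>k. moment k (a, x)) $ k"
    using assms by (simp add: vandermonde_0_2_def scalar_prod_def atLeast0LessThan mult.commute)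
qed

text \<open>The entries of \<open>vandermonde_0_2 x *\<^sub>v a\<close> are the first three moments,
  so condition (I) is the zero-signal alternative.\<close>

lemma mem_mat_kernel_vandermonde_0_2_iff:
  assumes "dim_vec a = dim_vec x"
  shows "a \<in> mat_kernel (vandermonde_0_2 x) \<longleftrightarrow> (\<forall>k \<in> {0, 1, 2}. moment k (a, x) = 0)"
proof -
  have "a \<in> mat_kernel (vandermonde_0_2 x) \<longleftrightarrow> vec 3 (\<lambda>k. moment k (a, x)) = 0\<^sub>v 3"
    \<comment> \<open>Kernel membership also demands that \<open>a\<close> have the right dimension,
      which the assumption supplies.\<close>
    unfolding mat_kernel[OF vandermonde_0_2_carrier] mem_Collect_eq
      vandermonde_0_2_mult_vec[OF assms]
    using carrier_vec_dim_vec[of a] assms by metis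
  also have "\<dots> \<longleftrightarrow> (\<forall>k<3. moment k (a, x) = 0)"
    unfolding vec_eq_iff by (simp del: moment.simps)
  also have "\<dots> \<longleftrightarrow> (\<forall>k \<in> {0, 1, 2}. moment k (a, x) = 0)"
    unfolding numeral_3_eq_3
    by (simp add: less_Suc_eq numeral_2_eq_2 all_conj_distrib imp_conjL del: moment.simps)
  finally show ?thesis .
qed

lemma dist_mat_quadratic_form:
  assumes "dim_vec a = dim_vec x"
  shows "a \<bullet> (dist_mat x *\<^sub>v a) =
    2 * (moment 0 (a, x) * moment 2 (a, x) - (moment 1 (a, x))\<^sup>2)"
proof -
  let ?n = "dim_vec a"
  have "a \<bullet> (dist_mat x *\<^sub>v a) = (\<Sum>i<?n. \<Sum>j<?n. a $ i * a $ j * (x $ i - x $ j)\<^sup>2)"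
    using assms by (simp add: dist_mat_def scalar_prod_def atLeast0LessThan sum_distrib_left ac_simps)
  \<comment> \<open>The grouping separates the factors in \<open>i\<close> from those in
    \<open>j\<close>, so each double sum becomes a product of two moments.\<close>
  also have "\<dots> = (\<Sum>i<?n. \<Sum>j<?n. (a $ i * (x $ i)\<^sup>2) * a $ j + a $ i * (a $ j * (x $ j)\<^sup>2)
      - 2 * ((a $ i * x $ i) * (a $ j * x $ j)))"
    by (intro sum.cong refl) (simp add: power2_eq_square algebra_simps)
  also have "\<dots> = 2 * (moment 0 (a, x) * moment 2 (a, x) - (moment 1 (a, x))\<^sup>2)"
    by (simp add: sum.distrib sum_subtractf flip: sum_distrib_left sum_product)
       (simp add: power2_eq_square flip: sum_distrib_right sum_distrib_left)
  finally show ?thesis .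
qed

theorem theorem2p1:
  fixes d :: nat and a x :: "real vec"
  assumes "d \<ge> 2" and "(a, x) \<in> \<P> d"
  shows "let condI = (moment 0 (a, x) = 0 \<and> a \<in> mat_kernel (vandermonde_0_2 x));
             condII = (moment 0 (a, x) \<noteq> 0 \<and> a \<bullet> (dist_mat x *\<^sub>v a) = 0)
         in ((a, x) \<in> Sigma_1_2 d \<longleftrightarrow>
               (\<forall>i<d. a $ i \<noteq> 0) \<and> ((condI \<and> \<not> condII) \<or> (\<not> condI \<and> condII)))
            \<and> \<not> (condI \<and> condII)"
proof -
  have dim: "dim_vec a = dim_vec x" and nz: "\<forall>i<d. a $ i \<noteq> 0"
    using assms(2) by (auto simp: signals_def)
  have "(a, x) \<in> Sigma_1_2 d \<longleftrightarrow> (\<forall>k \<in> {0, 1, 2}. moment k (a, x) = 0) \<or>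
      moment 0 (a, x) \<noteq> 0 \<and> moment 0 (a, x) * moment 2 (a, x) = (moment 1 (a, x))\<^sup>2"
    using assms(2) ex_signal_at_most_one_node_iff[of "\<lambda>k. moment k (a, x)"]
    by (simp add: Sigma_1_2_def del: moment.simps)
  \<comment> \<open>The two alternatives are now conditions (I) and (II). They disagree on whether
    the zeroth moment vanishes, so their disjunction is already exclusive.\<close>
  then show ?thesis
    using nz
    unfolding Let_def mem_mat_kernel_vandermonde_0_2_iff[OF dim] dist_mat_quadratic_form[OF dim]
    by (auto simp del: moment.simps)
qed

end
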